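(* Let $(A,\rightarrow,\rightsquigarrow,0,1)$ be a bounded pseudo-BE(A) algebra. Then $s\mapsto 1-s$ is a bijection from the set $\mathcal{BS}_1(A)$ of Bosbach states $s$ on $A$ with $s(0)=0$ onto the set $\mathcal{MS}(A)$ of state-measures on $A$, with inverse $m\mapsto 1-m$. In particular, there is a one-to-one correspondence between $\mathcal{BS}_1(A)$ and $\mathcal{MS}(A)$.
   Context: A pseudo-BE algebra is an algebra $(A,\rightarrow,\rightsquigarrow,1)$ of type $(2,2,0)$ such that for all $x,y,z\in A$: $x\rightarrow x=x\rightsquigarrow x=1$; $x\rightarrow 1=x\rightsquigarrow 1=1$; $1\rightarrow x=1\rightsquigarrow x=x$; $x\rightarrow(y\rightsquigarrow z)=y\rightsquigarrow(x\rightarrow z)$; $x\rightarrow y=1$ iff $x\rightsquigarrow y=1$. Write $x\le y$ iff $x\rightarrow y=1$. It is a pseudo-BE(A) algebra if $x\le y$ implies $y\rightarrow z\le x\rightarrow z$ and $y\rightsquigarrow z\le x\rightsquigarrow z$ for all $z$. It is bounded if there is $0\in A$ with $0\le x$ for all $x$. A Bosbach state is a map $s:A\to[0,1]$ with $s(1)=1$, $s(x)+s(x\rightarrow y)=s(y)+s(y\rightarrow x)$ and $s(x)+s(x\rightsquigarrow y)=s(y)+s(y\rightsquigarrow x)$ for all $x,y$. A measure is a map $m:A\to[0,\infty)$ such that $m(x\rightarrow y)=m(x\rightsquigarrow y)=m(y)-m(x)$ whenever $y\le x$; a state-measure (for bounded $A$) is a measure with $m(0)=1$. *)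

theory Defs
  imports Complex_Main
begin

text \<open>
  The carrier of an algebra is the type \<open>'a\<close>. In a pseudo-BE algebra \<open>\<sqsubseteq>\<close> is in general
  neither antisymmetric nor transitive; a bounded algebra comes with a chosen least element
  \<open>zero\<close>.
\<close>

locale pseudo_BE =
  fixes imp :: "'a \<Rightarrow> 'a \<Rightarrow> 'a" (infixr "\<rightarrow>" 60)
    and pimp :: "'a \<Rightarrow> 'a \<Rightarrow> 'a" (infixr "\<leadsto>" 60)
    and one :: 'a ("\<one>")
  assumes imp_refl: "x \<rightarrow> x = \<one>"
    and pimp_refl: "x \<leadsto> x = \<one>"
    and imp_one: "x \<rightarrow> \<one> = \<one>"
    and pimp_one: "x \<leadsto> \<one> = \<one>"
    and one_imp: "\<one> \<rightarrow> x = x"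
    and one_pimp: "\<one> \<leadsto> x = x"
    and exchange: "x \<rightarrow> (y \<leadsto> z) = y \<leadsto> (x \<rightarrow> z)"
    and imp_iff_pimp: "x \<rightarrow> y = \<one> \<longleftrightarrow> x \<leadsto> y = \<one>"
begin

definition le :: "'a \<Rightarrow> 'a \<Rightarrow> bool" (infix "\<sqsubseteq>" 50)
  where "x \<sqsubseteq> y \<longleftrightarrow> x \<rightarrow> y = \<one>"

definition bosbach_state :: "('a \<Rightarrow> real) \<Rightarrow> bool"
  where "bosbach_state s \<longleftrightarrow>
    (\<forall>x. 0 \<le> s x \<and> s x \<le> 1) \<and>
    s \<one> = 1 \<and>
    (\<forall>x y. s x + s (x \<rightarrow> y) = s y + s (y \<rightarrow> x)) \<and>
    (\<forall>x y. s x + s (x \<leadsto> y) = s y + s (y \<leadsto> x))"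

definition pBE_measure :: "('a \<Rightarrow> real) \<Rightarrow> bool"
  where "pBE_measure m \<longleftrightarrow>
    (\<forall>x. 0 \<le> m x) \<and>
    (\<forall>x y. y \<sqsubseteq> x \<longrightarrow> m (x \<rightarrow> y) = m y - m x \<and> m (x \<leadsto> y) = m y - m x)"

end

locale pseudo_BE_A = pseudo_BE +
  assumes imp_antitone: "x \<sqsubseteq> y \<Longrightarrow> (y \<rightarrow> z) \<sqsubseteq> (x \<rightarrow> z)"
    and pimp_antitone: "x \<sqsubseteq> y \<Longrightarrow> (y \<leadsto> z) \<sqsubseteq> (x \<leadsto> z)"

locale bounded_pseudo_BE = pseudo_BE +
  fixes zero :: 'a ("\<zero>")
  assumes zero_le: "\<zero> \<sqsubseteq> x"
begin

definition BS1 :: "('a \<Rightarrow> real) set"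
  where "BS1 = {s. bosbach_state s \<and> s \<zero> = 0}"

definition state_measure :: "('a \<Rightarrow> real) \<Rightarrow> bool"
  where "state_measure m \<longleftrightarrow> pBE_measure m \<and> m \<zero> = 1"

definition MS :: "('a \<Rightarrow> real) set"
  where "MS = {m. state_measure m}"

end

locale bounded_pseudo_BE_A = bounded_pseudo_BE + pseudo_BE_A

end

(* For a measure m, m (x \<rightarrow> y) = m y - m u for the pseudo-join u = (x \<rightarrow> y) \<leadsto> y, because x \<rightarrow> y and
   u \<rightarrow> y lie below each other. The Bosbach equation for 1 - m therefore says that the
   pseudo-joins of (x, y) and of (y, x) have the same measure, which follows from antitonicity
   and the fact that u lies above both x and y. The equation for \<leadsto> is the same
   statement in the algebra with the two implications swapped. *)
theory Submission
  imports Defs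
begin

context pseudo_BE
begin

lemma le_iff_pimp: "x \<sqsubseteq> y \<longleftrightarrow> x \<leadsto> y = \<one>"
  by (simp add: le_def imp_iff_pimp)

lemma le_pseudo_join_left: "x \<sqsubseteq> (x \<rightarrow> y) \<leadsto> y"
  by (simp add: le_def exchange pimp_refl)

lemma le_pseudo_join_right: "y \<sqsubseteq> (x \<rightarrow> y) \<leadsto> y"
  by (simp add: le_def exchange imp_refl pimp_one)

lemma le_imp: "y \<sqsubseteq> x \<rightarrow> y"
  by (simp add: le_iff_pimp exchange [symmetric] pimp_refl imp_one)

text \<open>By \<open>exchange\<close> this reduces to reflexivity of \<rightarrow> at the
  pseudo-join.\<close>

lemma imp_le_pseudo_join_imp: "x \<rightarrow> y \<sqsubseteq> ((x \<rightarrow> y) \<leadsto> y) \<rightarrow> y"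
  by (simp add: le_iff_pimp exchange [symmetric] imp_refl)

lemma measure_imp: "pBE_measure m \<Longrightarrow> y \<sqsubseteq> x \<Longrightarrow> m (x \<rightarrow> y) = m y - m x"
  by (simp add: pBE_measure_def)

lemma measure_pimp: "pBE_measure m \<Longrightarrow> y \<sqsubseteq> x \<Longrightarrow> m (x \<leadsto> y) = m y - m x"
  by (simp add: pBE_measure_def)

lemma measure_nonneg: "pBE_measure m \<Longrightarrow> 0 \<le> m x"
  by (simp add: pBE_measure_def)

lemma measure_one: "pBE_measure m \<Longrightarrow> m \<one> = 0"
  using measure_imp [of m \<one> \<one>] by (simp add: le_def imp_one)

text \<open>The difference \<open>m y - m x\<close> is itself a value of \<open>m\<close>, hence
  nonnegative.\<close>

lemma measure_antimono:
  assumes "pBE_measure m" and "y \<sqsubseteq> x"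
  shows "m x \<le> m y"
  using measure_imp [OF assms] measure_nonneg [OF assms(1), of "x \<rightarrow> y"] by simp

text \<open>Since \<open>y\<close> lies below both \<open>x \<rightarrow> y\<close> and
  \<open>x\<close>, the left side unfolds to \<open>m y - (m y - m x)\<close>.\<close>

lemma measure_pseudo_join_of_le:
  assumes "pBE_measure m" and "y \<sqsubseteq> x"
  shows "m ((x \<rightarrow> y) \<leadsto> y) = m x"
  using measure_pimp [OF assms(1) le_imp] measure_imp [OF assms] by simp

text \<open>For \<open>y \<sqsubseteq> x\<close> the last term of each Bosbach equation is
  \<open>s \<one> = 1\<close>, which leaves the measure identity for \<open>1 - s\<close>.\<close>

lemma bosbach_state_imp_measure:
  assumes "bosbach_state s"
  shows "pBE_measure (\<lambda>x. 1 - s x)"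
  unfolding pBE_measure_def
proof (intro conjI allI impI)
  fix x y
  show "0 \<le> 1 - s x"
    using assms by (simp add: bosbach_state_def)
  assume "y \<sqsubseteq> x"
  then have "y \<rightarrow> x = \<one>" "y \<leadsto> x = \<one>"
    by (simp_all add: le_def imp_iff_pimp)
  moreover have "s x + s (x \<rightarrow> y) = s y + s (y \<rightarrow> x)"
      "s x + s (x \<leadsto> y) = s y + s (y \<leadsto> x)" "s \<one> = 1"
    using assms unfolding bosbach_state_def by blast+
  ultimately show "1 - s (x \<rightarrow> y) = (1 - s y) - (1 - s x)"
      "1 - s (x \<leadsto> y) = (1 - s y) - (1 - s x)"
    by simp_all
qed

end

context pseudo_BE_A
begin

lemma measure_imp_eq_pseudo_join:
  assumes "pBE_measure m"
  shows "m (x \<rightarrow> y) = m y - m ((x \<rightarrow> y) \<leadsto> y)"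
proof -
  let ?u = "(x \<rightarrow> y) \<leadsto> y"
  have "m (x \<rightarrow> y) = m (?u \<rightarrow> y)"
    using measure_antimono [OF assms imp_antitone [OF le_pseudo_join_left]]
      measure_antimono [OF assms imp_le_pseudo_join_imp]
    by (rule antisym)
  then show ?thesis
    using measure_imp [OF assms le_pseudo_join_right] by simp
qed

text \<open>Let \<open>u\<close> be the pseudo-join on the left. From
  \<open>y \<sqsubseteq> u\<close>, two uses of antitonicity replace \<open>y\<close> by
  \<open>u\<close> in the right-hand pseudo-join and move it upwards; as
  \<open>x \<sqsubseteq> u\<close>, the result has measure \<open>m u\<close>.\<close>

lemma measure_pseudo_join_le:
  assumes "pBE_measure m"
  shows "m ((x \<rightarrow> y) \<leadsto> y) \<le> m ((y \<rightarrow> x) \<leadsto> x)"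
proof -
  let ?u = "(x \<rightarrow> y) \<leadsto> y"
  have "(y \<rightarrow> x) \<leadsto> x \<sqsubseteq> (?u \<rightarrow> x) \<leadsto> x"
    by (intro pimp_antitone imp_antitone le_pseudo_join_right)
  then have "m ((?u \<rightarrow> x) \<leadsto> x) \<le> m ((y \<rightarrow> x) \<leadsto> x)"
    by (rule measure_antimono [OF assms])
  then show ?thesis
    using measure_pseudo_join_of_le [OF assms le_pseudo_join_left] by simp
qed

lemma measure_bosbach_imp:
  assumes "pBE_measure m"
  shows "m x + m (x \<rightarrow> y) = m y + m (y \<rightarrow> x)"
  using measure_imp_eq_pseudo_join [OF assms, of x y]
    measure_imp_eq_pseudo_join [OF assms, of y x]
    measure_pseudo_join_le [OF assms, of x y] measure_pseudo_join_le [OF assms, of y x]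
  by simp

text \<open>The axioms are symmetric in the two implications: \<open>exchange\<close> becomes itself
  read backwards, and both implications induce the same order.\<close>

lemma pseudo_BE_A_swap: "pseudo_BE_A pimp imp \<one>"
proof
  show "x \<leadsto> y = \<one> \<longleftrightarrow> x \<rightarrow> y = \<one>" for x y
    by (simp add: imp_iff_pimp)
next
  interpret swap: pseudo_BE pimp imp \<one>
    by unfold_locales
      (simp_all add: imp_refl pimp_refl imp_one pimp_one one_imp one_pimp exchange imp_iff_pimp)
  show "swap.le (y \<leadsto> z) (x \<leadsto> z)" "swap.le (y \<rightarrow> z) (x \<rightarrow> z)" if "swap.le x y" for x y z
    using that imp_antitone pimp_antitone by (simp_all add: swap.le_def le_iff_pimp)
qed (simp_all add: imp_refl pimp_refl imp_one pimp_one one_imp one_pimp exchange)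

lemma measure_bosbach_pimp:
  assumes "pBE_measure m"
  shows "m x + m (x \<leadsto> y) = m y + m (y \<leadsto> x)"
proof -
  interpret swap: pseudo_BE_A pimp imp \<one>
    by (rule pseudo_BE_A_swap)
  \<comment> \<open>Measures treat both implications alike, so swapping preserves them.\<close>
  have "swap.pBE_measure m"
    using assms by (simp add: pBE_measure_def swap.pBE_measure_def swap.le_def le_iff_pimp)
  then show ?thesis
    by (rule swap.measure_bosbach_imp)
qed

lemma measure_imp_bosbach_state:
  assumes "pBE_measure m" and "\<And>x. m x \<le> 1"
  shows "bosbach_state (\<lambda>x. 1 - m x)"
  using assms measure_bosbach_imp [OF assms(1)] measure_bosbach_pimp [OF assms(1)]
  by (simp add: bosbach_state_def measure_one measure_nonneg algebra_simps)

end

context bounded_pseudo_BE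
begin

text \<open>As \<open>\<zero>\<close> is least, its measure 1 is the largest value of
  \<open>m\<close>; this keeps \<open>1 - m\<close> nonnegative.\<close>

lemma state_measure_le_one:
  assumes "state_measure m"
  shows "m x \<le> 1"
  using assms measure_antimono [OF _ zero_le] by (simp add: state_measure_def) metis

lemma BS1_imp_MS: "s \<in> BS1 \<Longrightarrow> (\<lambda>x. 1 - s x) \<in> MS"
  by (simp add: BS1_def MS_def state_measure_def bosbach_state_imp_measure)

end

lemma (in bounded_pseudo_BE_A) MS_imp_BS1: "m \<in> MS \<Longrightarrow> (\<lambda>x. 1 - m x) \<in> BS1"
  using state_measure_le_one [of m]
  by (simp add: BS1_def MS_def state_measure_def measure_imp_bosbach_state)

theorem theorem3p18:
  fixes imp pimp :: "'a \<Rightarrow> 'a \<Rightarrow> 'a" and one zero :: 'a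
  assumes "bounded_pseudo_BE_A imp pimp one zero"
  defines "BS \<equiv> bounded_pseudo_BE.BS1 imp pimp one zero"
    and "MS \<equiv> bounded_pseudo_BE.MS imp pimp one zero"
  shows "bij_betw (\<lambda>s x. 1 - s x) BS MS
    \<and> (\<forall>m\<in>MS. inv_into BS (\<lambda>s x. 1 - s x) m = (\<lambda>x. 1 - m x))
    \<and> (\<exists>f. bij_betw f BS MS)"
proof -
  interpret bounded_pseudo_BE_A imp pimp one zero
    by (rule assms(1))
  let ?c = "\<lambda>(s :: 'a \<Rightarrow> real) x. 1 - s x"
  have bij: "bij_betw ?c BS MS"
    \<comment> \<open>The map \<open>?c\<close> is an involution, so it serves as its own
      inverse.\<close>
    by (rule bij_betw_byWitness [where f' = ?c])
      (auto simp: assms(2,3) BS1_imp_MS MS_imp_BS1)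
  have "inv_into BS ?c m = ?c m" if "m \<in> MS" for m
    by (rule inv_into_f_eq) (use bij that in \<open>auto simp: bij_betw_def assms(2,3) MS_imp_BS1\<close>)
  with bij show ?thesis
    by blast
qed

end
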